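(* Let $n\ge 1$, $\lambda=(\lambda_1,\dots,\lambda_n)\in\mathbb{R}^n$, $\mu\in\mathbb{R}$ and $\delta=\mu-\sum_{i=1}^n\lambda_i$. 1) If $\delta\notin\mathbb{N}$, then $\mathrm{H}^1_{\mathrm{diff}}(\mathfrak{aff}(1),\mathrm{D}_{\lambda,\mu})=0$. 2) If $\delta\in\mathbb{N}$, then, up to a coboundary, any 1-cocycle $\Omega\in \mathrm{Z}^1_{\mathrm{diff}}(\mathfrak{aff}(1),\mathrm{D}_{\lambda,\mu})$ can be expressed as follows: for all $F=f_1\otimes\cdots\otimes f_n\in\mathcal{F}_{\lambda_1}\otimes\cdots\otimes\mathcal{F}_{\lambda_n}$ and all $X_h\in\mathfrak{aff}(1)$, $$\Omega(X_h,F)=\sum_{|\alpha|=\delta}B_\alpha\, h'\,F^{(\alpha)},$$ where the sum runs over $\alpha\in\mathbb{N}^n$ with $|\alpha|=\delta$ and the $B_\alpha$ are (real) constants.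
   Context: $\mathbb{N}=\{0,1,2,\dots\}$. For $\mu\in\mathbb{R}$, $\mathcal{F}_\mu=\{f\,dx^\mu : f\in C^\infty(\mathbb{R})\}$ is the space of $\mu$-densities on $\mathbb{R}$; densities are identified with their coefficient functions. For $h\in C^\infty(\mathbb{R})$ put $X_h=h\frac{d}{dx}$; it acts on $\mathcal{F}_\mu$ by $L^\mu_{X_h}(f)=hf'+\mu h'f$. The bracket is $[X_f,X_g]=X_{fg'-f'g}$. $\mathfrak{aff}(1)$ is the Lie algebra $\mathrm{Span}(X_1,X_x)$ (i.e. the $X_h$ with $h$ a polynomial of degree at most $1$). For $\alpha=(\alpha_1,\dots,\alpha_n)\in\mathbb{N}^n$ let $|\alpha|=\sum_i\alpha_i$, and for $F=f_1\otimes\cdots\otimes f_n$ let $F^{(\alpha)}=f_1^{(\alpha_1)}\cdots f_n^{(\alpha_n)}$. $\mathrm{D}_{\lambda,\mu}$ is the space of $n$-ary differential operators $\mathcal{F}_{\lambda_1}\otimes\cdots\otimes\mathcal{F}_{\lambda_n}\to\mathcal{F}_\mu$, i.e. of maps $F\mapsto\sum_\alpha a_\alpha F^{(\alpha)}$ (finite sum, $a_\alpha\in C^\infty(\mathbb{R})$). It is an $\mathfrak{aff}(1)$-module via $X_h\cdot A=L^\mu_{X_h}\circ A-A\circ L^\lambda_{X_h}$, where $L^\lambda_{X_h}(f_1\otimes\cdots\otimes f_n)=\sum_i f_1\otimes\cdots\otimes L^{\lambda_i}_{X_h}(f_i)\otimes\cdots\otimes f_n$. $\mathrm{Z}^1_{\mathrm{diff}}(\mathfrak{aff}(1),\mathrm{D}_{\lambda,\mu})$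 is the space of 1-cocycles, i.e. linear maps $\Omega:\mathfrak{aff}(1)\to\mathrm{D}_{\lambda,\mu}$ (given by differential operators, which is automatic here) with $\Omega([X,Y])=X\cdot\Omega(Y)-Y\cdot\Omega(X)$; write $\Omega(X_h,F)=\Omega(X_h)(F)$. Coboundaries are the maps $X\mapsto X\cdot b$ with $b\in\mathrm{D}_{\lambda,\mu}$, and $\mathrm{H}^1_{\mathrm{diff}}$ is the quotient of cocycles by coboundaries. "Up to a coboundary" means after subtracting a suitable coboundary. *)

theory Defs
  imports "HOL-Analysis.Analysis"
begin

definition smooth :: "(real \<Rightarrow> real) \<Rightarrow> bool" where
  "smooth f \<longleftrightarrow> (\<forall>k x. (deriv ^^ k) f differentiable (at x))"

text \<open>
  Densities are identified with their coefficient functions, and the vector field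
  \<open>X\<^sub>h\<close> with \<open>h\<close>. The index set of the \<open>n\<close> tensor factors is a finite type
  \<open>'n\<close>, so that \<open>n = CARD('n) \<ge> 1\<close>. A linear map on the tensor product is determined by its
  values on the decomposable tensors \<open>f\<^sub>1 \<otimes> \<dots> \<otimes> f\<^sub>n\<close>, so it is represented as a function
  of the tuple \<open>(f\<^sub>1, \<dots>, f\<^sub>n)\<close>.

  Functions on a carrier set (tuples of smooth functions, the Lie algebra) are extended by
  zero outside this set, so that equality of such maps is equality in HOL and the vector
  space operations are pointwise.
\<close>

type_synonym 'n nary_op = "('n \<Rightarrow> real \<Rightarrow> real) \<Rightarrow> real \<Rightarrow> real"

definition smooth_tuples :: "('n \<Rightarrow> real \<Rightarrow> real) set" where
  "smooth_tuples = {F. \<forall>i. smooth (F i)}"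

definition multi_deriv :: "('n::finite \<Rightarrow> nat) \<Rightarrow> ('n \<Rightarrow> real \<Rightarrow> real) \<Rightarrow> real \<Rightarrow> real" where
  "multi_deriv \<alpha> F = (\<lambda>x. \<Prod>i\<in>UNIV. (deriv ^^ \<alpha> i) (F i) x)"

definition lie_density :: "real \<Rightarrow> (real \<Rightarrow> real) \<Rightarrow> (real \<Rightarrow> real) \<Rightarrow> real \<Rightarrow> real" where
  "lie_density \<mu> h f = (\<lambda>x. h x * deriv f x + \<mu> * deriv h x * f x)"

definition vf_bracket :: "(real \<Rightarrow> real) \<Rightarrow> (real \<Rightarrow> real) \<Rightarrow> real \<Rightarrow> real" where
  "vf_bracket f g = (\<lambda>x. f x * deriv g x - deriv f x * g x)"

definition aff1 :: "(real \<Rightarrow> real) set" where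
  "aff1 = {h. \<exists>a b. h = (\<lambda>x. a + b * x)}"

text \<open>
  The underlying space of \<open>D\<^bsub>\<lambda>,\<mu>\<^esub>\<close>; the weights \<open>\<lambda>\<close> and \<open>\<mu>\<close> enter only
  through the module structure.
\<close>

definition diff_ops :: "'n::finite nary_op set" where
  "diff_ops = {A. \<exists>S a. finite S \<and> (\<forall>\<alpha>\<in>S. smooth (a \<alpha>)) \<and>
     A = (\<lambda>F x. if F \<in> smooth_tuples then \<Sum>\<alpha>\<in>S. a \<alpha> x * multi_deriv \<alpha> F x else 0)}"

definition op_action ::
  "('n::finite \<Rightarrow> real) \<Rightarrow> real \<Rightarrow> (real \<Rightarrow> real) \<Rightarrow> 'n nary_op \<Rightarrow> 'n nary_op" where
  "op_action lam \<mu> h A = (\<lambda>F x. if F \<in> smooth_tuples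
     then lie_density \<mu> h (A F) x - (\<Sum>i\<in>UNIV. A (F(i := lie_density (lam i) h (F i))) x)
     else 0)"

text \<open>
  One-cochains: linear maps from \<open>aff(1)\<close> to the differential operators. Dependence on
  \<open>h\<close> through a differential operator is automatic, since \<open>h\<close> is affine.
\<close>

definition cochains1 :: "((real \<Rightarrow> real) \<Rightarrow> 'n::finite nary_op) set" where
  "cochains1 = {\<Omega>. (\<forall>h\<in>aff1. \<Omega> h \<in> diff_ops) \<and>
     (\<forall>h\<in>aff1. \<forall>k\<in>aff1. \<Omega> (\<lambda>x. h x + k x) = (\<lambda>F x. \<Omega> h F x + \<Omega> k F x)) \<and>
     (\<forall>c. \<forall>h\<in>aff1. \<Omega> (\<lambda>x. c * h x) = (\<lambda>F x. c * \<Omega> h F x)) \<and>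
     (\<forall>h. h \<notin> aff1 \<longrightarrow> \<Omega> h = (\<lambda>F x. 0))}"

definition cocycles1 ::
  "('n::finite \<Rightarrow> real) \<Rightarrow> real \<Rightarrow> ((real \<Rightarrow> real) \<Rightarrow> 'n nary_op) set" where
  "cocycles1 lam \<mu> = {\<Omega> \<in> cochains1. \<forall>h\<in>aff1. \<forall>k\<in>aff1.
     \<Omega> (vf_bracket h k) = (\<lambda>F x. op_action lam \<mu> h (\<Omega> k) F x - op_action lam \<mu> k (\<Omega> h) F x)}"

definition coboundaries1 ::
  "('n::finite \<Rightarrow> real) \<Rightarrow> real \<Rightarrow> ((real \<Rightarrow> real) \<Rightarrow> 'n nary_op) set" where
  "coboundaries1 lam \<mu> =
     {(\<lambda>h. if h \<in> aff1 then op_action lam \<mu> h b else (\<lambda>F x. 0)) | b. b \<in> diff_ops}"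

definition cohomologous ::
  "('n::finite \<Rightarrow> real) \<Rightarrow> real \<Rightarrow> ((real \<Rightarrow> real) \<Rightarrow> 'n nary_op) rel" where
  "cohomologous lam \<mu> = {(\<Omega>, \<Omega>'). \<Omega> \<in> cocycles1 lam \<mu> \<and> \<Omega>' \<in> cocycles1 lam \<mu> \<and>
     (\<lambda>h F x. \<Omega> h F x - \<Omega>' h F x) \<in> coboundaries1 lam \<mu>}"

text \<open>The zero element of this quotient is the class \<^term>\<open>coboundaries1 lam \<mu>\<close>.\<close>

definition cohomology1 ::
  "('n::finite \<Rightarrow> real) \<Rightarrow> real \<Rightarrow> ((real \<Rightarrow> real) \<Rightarrow> 'n nary_op) set set" where
  "cohomology1 lam \<mu> = cocycles1 lam \<mu> // cohomologous lam \<mu>"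

lemma finite_multi_indices: "finite {\<alpha> :: 'n::finite \<Rightarrow> nat. (\<Sum>i\<in>UNIV. \<alpha> i) = d}"
proof (rule finite_subset)
  show "{\<alpha> :: 'n \<Rightarrow> nat. (\<Sum>i\<in>UNIV. \<alpha> i) = d} \<subseteq> (UNIV \<rightarrow>\<^sub>E {..d})"
    by (auto simp: PiE_def intro: member_le_sum)
  show "finite ((UNIV :: 'n set) \<rightarrow>\<^sub>E {..d})"
    by (intro finite_PiE) auto
qed

end

theory Submission
  imports Defs
begin

text \<open>
  On coefficients \<open>(a\<^sub>\<alpha>)\<close>, the field \<open>X\<^sub>h\<close> with \<open>h\<close> affine acts diagonally, by
  \<open>a\<^sub>\<alpha> \<mapsto> h a\<^sub>\<alpha>' + (\<delta> - |\<alpha>|) h' a\<^sub>\<alpha>\<close>. Let a cocycle have coefficients \<open>a\<^sub>\<alpha>\<close> at \<open>X\<^sub>1\<close>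
  and \<open>b\<^sub>\<alpha>\<close> at \<open>X\<^sub>x\<close>, and let \<open>g\<^sub>\<alpha>\<close> be a primitive of \<open>a\<^sub>\<alpha>\<close>. The cocycle identity at
  \<open>[X\<^sub>1, X\<^sub>x] = X\<^sub>1\<close> says exactly that \<open>c\<^sub>\<alpha> = b\<^sub>\<alpha> - x a\<^sub>\<alpha> - (\<delta> - |\<alpha>|) g\<^sub>\<alpha>\<close> is constant.
  Adding \<open>c\<^sub>\<alpha> / (\<delta> - |\<alpha>|)\<close> to \<open>g\<^sub>\<alpha>\<close> where \<open>|\<alpha>| \<noteq> \<delta>\<close> gives an operator whose coboundary
  agrees with the cocycle up to the terms \<open>c\<^sub>\<alpha> h' F\<^sup>(\<^sup>\<alpha>\<^sup>)\<close> with \<open>|\<alpha>| = \<delta>\<close>.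
\<close>

subsection \<open>Smooth functions\<close>

text \<open>Smoothness cut off at a finite order. Closure under sums and products is proved by
  induction on this order, since one derivative trades order \<open>Suc n\<close> for order
  \<open>n\<close>.\<close>

definition differentiable_upto :: "nat \<Rightarrow> (real \<Rightarrow> real) \<Rightarrow> bool" where
  "differentiable_upto n f \<longleftrightarrow> (\<forall>k\<le>n. \<forall>x. (deriv ^^ k) f differentiable (at x))"

lemma smooth_iff_differentiable_upto: "smooth f \<longleftrightarrow> (\<forall>n. differentiable_upto n f)"
  by (auto simp: smooth_def differentiable_upto_def)

lemma differentiable_upto_0:
  "differentiable_upto 0 f \<longleftrightarrow> (\<forall>x. f differentiable (at x))"
  by (simp add: differentiable_upto_def)

lemma differentiable_upto_Suc:
  "differentiable_upto (Suc n) f \<longleftrightarrow>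
     (\<forall>x. f differentiable (at x)) \<and> differentiable_upto n (deriv f)"
  by (simp add: differentiable_upto_def less_Suc_eq_le[symmetric] All_less_Suc2 funpow_Suc_right
      del: funpow.simps(2))

lemma differentiable_upto_SucD: "differentiable_upto (Suc n) f \<Longrightarrow> differentiable_upto n f"
  by (auto simp: differentiable_upto_def)

lemma deriv_real_eqI:
  fixes f :: "real \<Rightarrow> real"
  shows "(\<And>x. (f has_real_derivative g x) (at x)) \<Longrightarrow> deriv f = g"
  using DERIV_imp_deriv by blast

lemma differentiable_uptoD:
  "differentiable_upto n f \<Longrightarrow> (f has_real_derivative deriv f x) (at x)"
  by (cases n) (auto simp: differentiable_upto_0 differentiable_upto_Suc DERIV_deriv_iff_real_differentiable)

lemma differentiable_upto_add:
  "differentiable_upto n f \<Longrightarrow> differentiable_upto n g \<Longrightarrow> differentiable_upto n (\<lambda>x. f x + g x)"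
proof (induction n arbitrary: f g)
  case 0
  then show ?case by (simp add: differentiable_upto_0)
next
  case (Suc n)
  have "deriv (\<lambda>x. f x + g x) = (\<lambda>x. deriv f x + deriv g x)"
    by (intro deriv_real_eqI DERIV_add Suc.prems[THEN differentiable_uptoD])
  then show ?case
    using Suc by (simp add: differentiable_upto_Suc)
qed

text \<open>Leibniz gives a sum of two products, each pairing one derived factor with one underived
  factor. The underived factors are lowered to order \<open>n\<close>, and the induction hypothesis
  has to cover all pairs of functions.\<close>

lemma differentiable_upto_mult:
  "differentiable_upto n f \<Longrightarrow> differentiable_upto n g \<Longrightarrow> differentiable_upto n (\<lambda>x. f x * g x)"
proof (induction n arbitrary: f g)
  case 0
  then show ?case by (simp add: differentiable_upto_0)
next
  case (Suc n)
  have "deriv (\<lambda>x. f x * g x) = (\<lambda>x. f x * deriv g x + deriv f x * g x)"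
    by (rule deriv_real_eqI, rule DERIV_mult') (rule Suc.prems[THEN differentiable_uptoD])+
  moreover have "differentiable_upto n f" "differentiable_upto n g"
    using Suc.prems by (simp_all add: differentiable_upto_SucD)
  ultimately show ?case
    using Suc by (simp add: differentiable_upto_Suc differentiable_upto_add)
qed

lemma smooth_add: "smooth f \<Longrightarrow> smooth g \<Longrightarrow> smooth (\<lambda>x. f x + g x)"
  and smooth_mult: "smooth f \<Longrightarrow> smooth g \<Longrightarrow> smooth (\<lambda>x. f x * g x)"
  by (simp_all add: smooth_iff_differentiable_upto differentiable_upto_add differentiable_upto_mult)

lemma smooth_iff_deriv: "smooth f \<longleftrightarrow> (\<forall>x. f differentiable (at x)) \<and> smooth (deriv f)"
proof -
  have "smooth f \<longleftrightarrow> (\<forall>n. differentiable_upto (Suc n) f)"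
    by (meson differentiable_upto_SucD smooth_iff_differentiable_upto)
  then show ?thesis
    by (simp add: differentiable_upto_Suc smooth_iff_differentiable_upto)
qed

lemma smooth_deriv: "smooth f \<Longrightarrow> smooth (deriv f)"
  by (simp add: smooth_iff_deriv[of f])

lemma smooth_has_derivative: "smooth f \<Longrightarrow> (f has_real_derivative deriv f x) (at x)"
  by (simp add: smooth_iff_deriv[of f] DERIV_deriv_iff_real_differentiable)

lemma smooth_const: "smooth (\<lambda>x. c)"
proof -
  have "differentiable_upto n (\<lambda>x. c)" for n
    by (induction n arbitrary: c) (simp_all add: differentiable_upto_0 differentiable_upto_Suc)
  then show ?thesis by (simp add: smooth_iff_differentiable_upto)
qed

lemma smooth_ident: "smooth (\<lambda>x. x)"
  by (subst smooth_iff_deriv) (simp add: smooth_const)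

lemma smooth_power: "smooth f \<Longrightarrow> smooth (\<lambda>x. f x ^ n)"
  by (induction n) (simp_all add: smooth_const smooth_mult)

text \<open>Continuity provides an antiderivative on the whole line, and a differentiable function
  with smooth derivative is smooth.\<close>

lemma smooth_antiderivative:
  assumes "smooth f"
  obtains g where "smooth g" "deriv g = f"
proof -
  have "isCont f x" for x
    using smooth_has_derivative[OF assms] by (rule DERIV_isCont)
  then obtain g where "\<forall>x. -\<infinity> < ereal x \<longrightarrow> ereal x < \<infinity> \<longrightarrow> (g has_vector_derivative f x) (at x)"
    using einterval_antiderivative[of "-\<infinity>" "\<infinity>" f] by auto
  then have g: "(g has_real_derivative f x) (at x)" for x
    by (simp add: has_real_derivative_iff_has_vector_derivative)
  then have "deriv g = f" by (rule deriv_real_eqI)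
  moreover have "g differentiable (at x)" for x
    using g real_differentiable_def by blast
  ultimately have "smooth g" using assms by (subst smooth_iff_deriv) simp
  then show ?thesis using \<open>deriv g = f\<close> that by blast
qed

lemma smooth_iterated_deriv: "smooth f \<Longrightarrow> smooth ((deriv ^^ k) f)"
  by (induction k) (auto intro: smooth_deriv)

text \<open>Gives the slope a name that does not depend on chosen coefficients of \<open>h\<close>;
  later proofs abbreviate it by a constant \<open>q\<close> before differentiating.\<close>

lemma deriv_affine: "h \<in> aff1 \<Longrightarrow> deriv h = (\<lambda>_. deriv h 0)"
proof -
  assume "h \<in> aff1"
  then obtain a b where h: "h = (\<lambda>x. a + b * x)" by (auto simp: aff1_def)
  have "deriv h = (\<lambda>_. b)"
    unfolding h by (rule deriv_real_eqI) (auto intro!: derivative_eq_intros)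
  then show ?thesis by simp
qed

lemma smooth_affine: "h \<in> aff1 \<Longrightarrow> smooth h"
  by (auto simp: aff1_def intro!: smooth_add smooth_mult smooth_const smooth_ident)

lemma smooth_lie_density: "smooth h \<Longrightarrow> smooth f \<Longrightarrow> smooth (lie_density \<mu> h f)"
  unfolding lie_density_def by (intro smooth_add smooth_mult smooth_const smooth_deriv)

text \<open>As h'' = 0, each further derivative of h f' contributes just one extra h' term. Hence
  the k-th derivative of a density of weight l transforms like a density of weight k + l.\<close>

lemma iterated_deriv_lie_density:
  assumes "h \<in> aff1" "smooth f"
  shows "(deriv ^^ k) (lie_density l h f) x =
    h x * (deriv ^^ Suc k) f x + (real k + l) * deriv h x * (deriv ^^ k) f x"
proof (induction k arbitrary: x)
  case 0
  then show ?case by (simp add: lie_density_def)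
next
  case (Suc k)
  define q where "q = deriv h 0"
  have q: "deriv h = (\<lambda>_. q)"
    unfolding q_def by (rule deriv_affine[OF assms(1)])
  have h: "(h has_real_derivative q) (at x)" for x
    using smooth_has_derivative[OF smooth_affine[OF assms(1)], of x] by (simp add: q)
  have f: "((deriv ^^ j) f has_real_derivative (deriv ^^ Suc j) f x) (at x)" for j x
    using smooth_has_derivative[OF smooth_iterated_deriv[OF assms(2)], of j x] by simp
  have "(deriv ^^ k) (lie_density l h f) =
      (\<lambda>x. h x * (deriv ^^ Suc k) f x + (real k + l) * q * (deriv ^^ k) f x)"
    using Suc.IH by (simp add: q fun_eq_iff)
  then have "(deriv ^^ Suc k) (lie_density l h f) =
      deriv (\<lambda>x. h x * (deriv ^^ Suc k) f x + (real k + l) * q * (deriv ^^ k) f x)"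
    by simp
  also have "\<dots> = (\<lambda>x. (h x * (deriv ^^ Suc (Suc k)) f x + q * (deriv ^^ Suc k) f x)
      + (real k + l) * q * (deriv ^^ Suc k) f x)"
    by (intro deriv_real_eqI DERIV_add DERIV_cmult DERIV_mult' h f)
  finally show ?case by (simp add: q algebra_simps)
qed

subsection \<open>Operators and their coefficients\<close>

text \<open>Makes support and coefficients explicit arguments, so that cocycles can be handled
  through their coefficient families.\<close>

definition diff_op ::
  "('n::finite \<Rightarrow> nat) set \<Rightarrow> (('n \<Rightarrow> nat) \<Rightarrow> real \<Rightarrow> real) \<Rightarrow> 'n nary_op" where
  "diff_op S a = (\<lambda>F x. if F \<in> smooth_tuples then \<Sum>\<alpha>\<in>S. a \<alpha> x * multi_deriv \<alpha> F x else 0)"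

lemma diff_ops_altdef: "diff_ops = {diff_op S a | S a. finite S \<and> (\<forall>\<alpha>\<in>S. smooth (a \<alpha>))}"
  unfolding diff_ops_def diff_op_def by blast

lemma diff_op_in_diff_ops: "finite S \<Longrightarrow> (\<And>\<alpha>. \<alpha> \<in> S \<Longrightarrow> smooth (a \<alpha>)) \<Longrightarrow> diff_op S a \<in> diff_ops"
  unfolding diff_ops_altdef by blast

lemma diff_op_extend:
  assumes "finite T" "S \<subseteq> T"
  shows "diff_op S a = diff_op T (\<lambda>\<alpha>. if \<alpha> \<in> S then a \<alpha> else (\<lambda>x. 0))"
proof -
  have "(\<Sum>\<alpha>\<in>S. a \<alpha> x * multi_deriv \<alpha> F x) =
      (\<Sum>\<alpha>\<in>T. (if \<alpha> \<in> S then a \<alpha> else (\<lambda>x. 0)) x * multi_deriv \<alpha> F x)" for F x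
    using assms by (intro sum.mono_neutral_cong_left) auto
  then show ?thesis by (simp only: diff_op_def)
qed

text \<open>Both supports are enlarged to their union by zero coefficients. The new coefficients are
  smooth at every index, so later smoothness conditions need no membership in the support.\<close>

lemma diff_ops_common_support:
  assumes "A \<in> diff_ops" "B \<in> diff_ops"
  obtains S a b where "finite S" "\<And>\<alpha>. smooth (a \<alpha>)" "\<And>\<alpha>. smooth (b \<alpha>)"
    "A = diff_op S a" "B = diff_op S b"
proof -
  obtain S a where A: "finite S" "\<forall>\<alpha>\<in>S. smooth (a \<alpha>)" "A = diff_op S a"
    using assms(1) unfolding diff_ops_altdef by blast
  obtain T b where B: "finite T" "\<forall>\<alpha>\<in>T. smooth (b \<alpha>)" "B = diff_op T b"
    using assms(2) unfolding diff_ops_altdef by blast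
  show ?thesis
  proof
    show "A = diff_op (S \<union> T) (\<lambda>\<alpha>. if \<alpha> \<in> S then a \<alpha> else (\<lambda>x. 0))"
      unfolding A(3) by (rule diff_op_extend) (use A B in auto)
    show "B = diff_op (S \<union> T) (\<lambda>\<alpha>. if \<alpha> \<in> T then b \<alpha> else (\<lambda>x. 0))"
      unfolding B(3) by (rule diff_op_extend) (use A B in auto)
  qed (use A B in \<open>auto simp: smooth_const\<close>)
qed

lemma diff_ops_obtain:
  assumes "A \<in> diff_ops"
  obtains S a where "finite S" "\<And>\<alpha>. smooth (a \<alpha>)" "A = diff_op S a"
  by (rule diff_ops_common_support[OF assms assms]) (rule that)

lemma diff_op_lincomb:
  "(\<lambda>F x. s * diff_op S a F x + t * diff_op S b F x) = diff_op S (\<lambda>\<alpha> x. s * a \<alpha> x + t * b \<alpha> x)"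
  by (simp add: diff_op_def fun_eq_iff sum.distrib sum_distrib_left algebra_simps)

text \<open>The Pochhammer symbol is the falling factorial m (m - 1) ... (m - k + 1). It vanishes
  for k > m, which makes the truncated exponent \<open>m - k\<close> harmless. The factor
  \<open>c\<close> absorbs the constant produced by each differentiation in the induction.\<close>

lemma iterated_deriv_shifted_power:
  "(deriv ^^ k) (\<lambda>y. c * (y - x) ^ m) = (\<lambda>y::real. c * pochhammer (real m - real k + 1) k * (y - x) ^ (m - k))"
proof (induction k arbitrary: c m)
  case 0
  then show ?case by simp
next
  case (Suc k)
  show ?case
  proof (cases m)
    case 0
    have "(deriv ^^ j) (\<lambda>y::real. 0::real) = (\<lambda>y. 0)" for j
      by (induction j) simp_all
    moreover have "pochhammer (- real k) (Suc k) = 0"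
      by (simp add: pochhammer_of_nat_eq_0_iff)
    ultimately show ?thesis
      by (simp add: 0 funpow_Suc_right del: funpow.simps)
  next
    case (Suc l)
    have "deriv (\<lambda>y. c * (y - x) ^ m) = (\<lambda>y. (c * real m) * (y - x) ^ (m - Suc 0))"
      by (rule deriv_real_eqI) (auto intro!: derivative_eq_intros)
    then show ?thesis
      using Suc.IH[of "c * real m" l]
      by (simp add: Suc funpow_Suc_right pochhammer_rec' algebra_simps del: funpow.simps)
  qed
qed

text \<open>Testing on \<open>f\<^sub>i(y) = (y - x)^\<beta>\<^sub>i\<close> isolates the coefficient of index \<open>\<beta>\<close> at \<open>x\<close>.\<close>

lemma diff_op_coeff_unique:
  assumes "finite S" "diff_op S a = diff_op S b" "\<beta> \<in> S"
  shows "a \<beta> = b \<beta>"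
proof
  fix x
  \<comment> \<open>The factor 1 plays the part of \<open>c\<close> in
    \<open>iterated_deriv_shifted_power\<close>.\<close>
  define F :: "'a \<Rightarrow> real \<Rightarrow> real" where "F = (\<lambda>i y. 1 * (y - x) ^ \<beta> i)"
  have "smooth (\<lambda>y. y - x)"
    using smooth_add[OF smooth_ident smooth_const, of "-x"] by simp
  then have F: "F \<in> smooth_tuples"
    by (simp add: smooth_tuples_def F_def smooth_power)
  \<comment> \<open>With fewer than \<open>\<beta> i\<close> derivatives a positive power of y - x
    survives and vanishes at x; with more, the Pochhammer factor is zero.\<close>
  have D: "(deriv ^^ k) (F i) x \<noteq> 0 \<longleftrightarrow> k = \<beta> i" for k i
  proof -
    have "pochhammer (real (\<beta> i) - real k + 1) k \<noteq> 0" if "k \<le> \<beta> i"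
      using that by (intro pochhammer_pos less_imp_neq[THEN not_sym]) simp
    moreover have "pochhammer (real (\<beta> i) - real k + 1) k = 0" if "\<beta> i < k"
    proof -
      have eq: "real (\<beta> i) - real k + 1 = - real (k - Suc (\<beta> i))"
        using that by (simp add: of_nat_diff)
      show ?thesis
        unfolding eq pochhammer_of_nat_eq_0_iff using that by simp
    qed
    ultimately show ?thesis
      unfolding F_def iterated_deriv_shifted_power by (cases k "\<beta> i" rule: linorder_cases) simp_all
  qed
  have M: "multi_deriv \<alpha> F x \<noteq> 0 \<longleftrightarrow> \<alpha> = \<beta>" for \<alpha>
    by (simp add: multi_deriv_def D fun_eq_iff)
  have "diff_op S c F x = c \<beta> x * multi_deriv \<beta> F x" for c
  proof -
    have "diff_op S c F x = (\<Sum>\<alpha>\<in>S. if \<alpha> = \<beta> then c \<alpha> x * multi_deriv \<alpha> F x else 0)"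
      using F M by (auto simp: diff_op_def intro!: sum.cong)
    then show ?thesis using assms by simp
  qed
  with assms(2) M show "a \<beta> x = b \<beta> x"
    by (metis mult_right_cancel)
qed

subsection \<open>The action on coefficients\<close>

text \<open>For each index this is \<open>lie_density\<close> of weight \<delta> - |\<alpha>|
  applied to the coefficient: the coefficients are themselves densities, of weights depending on the
  order of the index.\<close>

definition coeff_action ::
  "real \<Rightarrow> (real \<Rightarrow> real) \<Rightarrow> (('n::finite \<Rightarrow> nat) \<Rightarrow> real \<Rightarrow> real) \<Rightarrow> ('n \<Rightarrow> nat) \<Rightarrow> real \<Rightarrow> real" where
  "coeff_action \<delta> h a = (\<lambda>\<alpha> x. h x * deriv (a \<alpha>) x + (\<delta> - real (\<Sum>i\<in>UNIV. \<alpha> i)) * deriv h x * a \<alpha> x)"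

lemma smooth_coeff_action:
  "h \<in> aff1 \<Longrightarrow> smooth (a \<alpha>) \<Longrightarrow> smooth (coeff_action \<delta> h a \<alpha>)"
  unfolding coeff_action_def
  by (intro smooth_add smooth_mult smooth_const) (simp_all add: smooth_deriv smooth_affine)

text \<open>Splits off the i-th factor, which is the shape of the i-th summand in the product rule
  for \<open>multi_deriv\<close>.\<close>

lemma multi_deriv_update_Suc:
  "multi_deriv (\<alpha>(i := Suc (\<alpha> i))) F x =
     (deriv ^^ Suc (\<alpha> i)) (F i) x * (\<Prod>j\<in>UNIV - {i}. (deriv ^^ \<alpha> j) (F j) x)"
proof -
  have "(\<Prod>j\<in>UNIV - {i}. (deriv ^^ (\<alpha>(i := Suc (\<alpha> i))) j) (F j) x) =
      (\<Prod>j\<in>UNIV - {i}. (deriv ^^ \<alpha> j) (F j) x)"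
    by (intro prod.cong) auto
  then show ?thesis
    unfolding multi_deriv_def by (subst prod.remove[of UNIV i]) (simp_all del: funpow.simps)
qed

lemma multi_deriv_has_derivative:
  assumes "F \<in> smooth_tuples"
  shows "(multi_deriv \<alpha> F has_real_derivative (\<Sum>i\<in>UNIV. multi_deriv (\<alpha>(i := Suc (\<alpha> i))) F x)) (at x)"
proof -
  have "((deriv ^^ \<alpha> i) (F i) has_real_derivative (deriv ^^ Suc (\<alpha> i)) (F i) x) (at x)" for i
    using assms smooth_has_derivative[OF smooth_iterated_deriv] by (simp add: smooth_tuples_def)
  then show ?thesis
    unfolding multi_deriv_update_Suc unfolding multi_deriv_def
    by (intro has_field_derivative_prod)
qed

lemma multi_deriv_update_lie_density:
  assumes "F \<in> smooth_tuples" "h \<in> aff1"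
  shows "multi_deriv \<alpha> (F(i := lie_density l h (F i))) x =
    h x * multi_deriv (\<alpha>(i := Suc (\<alpha> i))) F x + (real (\<alpha> i) + l) * deriv h x * multi_deriv \<alpha> F x"
proof -
  let ?P = "\<Prod>j\<in>UNIV - {i}. (deriv ^^ \<alpha> j) (F j) x"
  have "smooth (F i)" using assms by (simp add: smooth_tuples_def)
  note L = iterated_deriv_lie_density[OF assms(2) this]
  have "(\<Prod>j\<in>UNIV - {i}. (deriv ^^ \<alpha> j) ((F(i := lie_density l h (F i))) j) x) = ?P"
    by (intro prod.cong) auto
  then have "multi_deriv \<alpha> (F(i := lie_density l h (F i))) x =
      (deriv ^^ \<alpha> i) (lie_density l h (F i)) x * ?P"
    unfolding multi_deriv_def by (subst prod.remove[of UNIV i]) simp_all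
  moreover have "multi_deriv \<alpha> F x = (deriv ^^ \<alpha> i) (F i) x * ?P"
    unfolding multi_deriv_def by (subst prod.remove[of UNIV i]) simp_all
  ultimately show ?thesis
    unfolding L multi_deriv_update_Suc by (simp only: algebra_simps)
qed

text \<open>Differentiating F^(\<alpha>) and acting on the arguments both produce h times the sum of
  the derivatives with one index raised. These terms cancel, so the support does not grow; the h'
  terms left over add up to \<mu> - |\<alpha>| - sum of the \<open>lam i\<close>.\<close>

lemma op_action_diff_op:
  assumes S: "finite S" and a: "\<And>\<alpha>. \<alpha> \<in> S \<Longrightarrow> smooth (a \<alpha>)" and h: "h \<in> aff1"
  shows "op_action lam \<mu> h (diff_op S a) = diff_op S (coeff_action (\<mu> - (\<Sum>i\<in>UNIV. lam i)) h a)"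
proof (intro ext)
  fix F x
  show "op_action lam \<mu> h (diff_op S a) F x =
    diff_op S (coeff_action (\<mu> - (\<Sum>i\<in>UNIV. lam i)) h a) F x"
  proof (cases "F \<in> smooth_tuples")
    case False
    then show ?thesis by (simp add: op_action_def diff_op_def)
  next
    case F: True
    let ?M = "\<lambda>\<alpha>. multi_deriv \<alpha> F x"
    define D where "D = (\<lambda>\<alpha>. \<Sum>i\<in>UNIV. multi_deriv (\<alpha>(i := Suc (\<alpha> i))) F x)"
    have M: "(multi_deriv \<alpha> F has_real_derivative D \<alpha>) (at x)" for \<alpha>
      unfolding D_def by (rule multi_deriv_has_derivative[OF F])
    have "((\<lambda>x. \<Sum>\<alpha>\<in>S. a \<alpha> x * multi_deriv \<alpha> F x) has_real_derivative
        (\<Sum>\<alpha>\<in>S. a \<alpha> x * D \<alpha> + deriv (a \<alpha>) x * ?M \<alpha>)) (at x)"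
      by (intro DERIV_sum DERIV_mult' M smooth_has_derivative a)
    then have 1: "deriv (diff_op S a F) x = (\<Sum>\<alpha>\<in>S. a \<alpha> x * D \<alpha> + deriv (a \<alpha>) x * ?M \<alpha>)"
      using F by (simp add: diff_op_def DERIV_imp_deriv)
    have "F(i := lie_density (lam i) h (F i)) \<in> smooth_tuples" for i
      using F by (simp add: smooth_tuples_def smooth_lie_density smooth_affine[OF h])
    then have "diff_op S a (F(i := lie_density (lam i) h (F i))) x =
        (\<Sum>\<alpha>\<in>S. a \<alpha> x * (h x * multi_deriv (\<alpha>(i := Suc (\<alpha> i))) F x
          + (real (\<alpha> i) + lam i) * deriv h x * ?M \<alpha>))" for i
      by (simp add: diff_op_def multi_deriv_update_lie_density[OF F h])
    then have "(\<Sum>i\<in>UNIV. diff_op S a (F(i := lie_density (lam i) h (F i))) x) =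
        (\<Sum>\<alpha>\<in>S. \<Sum>i\<in>UNIV. a \<alpha> x * (h x * multi_deriv (\<alpha>(i := Suc (\<alpha> i))) F x
          + (real (\<alpha> i) + lam i) * deriv h x * ?M \<alpha>))"
      by (simp only:) (rule sum.swap)
    also have "\<dots> = (\<Sum>\<alpha>\<in>S. a \<alpha> x * (h x * D \<alpha>
        + (real (\<Sum>i\<in>UNIV. \<alpha> i) + (\<Sum>i\<in>UNIV. lam i)) * deriv h x * ?M \<alpha>))"
      by (simp add: D_def sum_distrib_left[symmetric] sum_distrib_right[symmetric] sum.distrib)
    finally have "op_action lam \<mu> h (diff_op S a) F x =
        h x * (\<Sum>\<alpha>\<in>S. a \<alpha> x * D \<alpha> + deriv (a \<alpha>) x * ?M \<alpha>)
        + \<mu> * deriv h x * (\<Sum>\<alpha>\<in>S. a \<alpha> x * ?M \<alpha>)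
        - (\<Sum>\<alpha>\<in>S. a \<alpha> x * (h x * D \<alpha>
          + (real (\<Sum>i\<in>UNIV. \<alpha> i) + (\<Sum>i\<in>UNIV. lam i)) * deriv h x * ?M \<alpha>))"
      using F 1 by (simp add: op_action_def lie_density_def) (simp add: diff_op_def)
    \<comment> \<open>The terms with \<open>D \<alpha>\<close> cancel index by index.\<close>
    also have "\<dots> = (\<Sum>\<alpha>\<in>S. coeff_action (\<mu> - (\<Sum>i\<in>UNIV. lam i)) h a \<alpha> x * ?M \<alpha>)"
      unfolding sum_distrib_left sum.distrib[symmetric] sum_subtractf[symmetric] coeff_action_def
      by (intro sum.cong refl) (simp only: algebra_simps)
    finally show ?thesis using F by (simp add: diff_op_def)
  qed
qed

text \<open>In the commutator the terms with a'', with the weight and with its square are symmetric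
  in h and k and drop out, leaving (h k' - h' k) a'. The left side has no weight term either,
  because the bracket of two affine fields is constant.\<close>

lemma coeff_action_bracket:
  assumes "h \<in> aff1" "k \<in> aff1" "smooth (a \<alpha>)"
  shows "coeff_action \<delta> (vf_bracket h k) a \<alpha> x =
    coeff_action \<delta> h (coeff_action \<delta> k a) \<alpha> x - coeff_action \<delta> k (coeff_action \<delta> h a) \<alpha> x"
proof -
  define m where "m = \<delta> - real (\<Sum>i\<in>UNIV. \<alpha> i)"
  have D: "deriv (coeff_action \<delta> u a \<alpha>) x = u x * deriv (deriv (a \<alpha>)) x + deriv u x * deriv (a \<alpha>) x
      + m * deriv u x * deriv (a \<alpha>) x" if "u \<in> aff1" for u
  proof -
    define q where "q = deriv u 0"
    have q: "deriv u = (\<lambda>_. q)" unfolding q_def by (rule deriv_affine[OF that])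
    show ?thesis
      unfolding coeff_action_def m_def[symmetric] q
      by (intro DERIV_imp_deriv DERIV_add DERIV_mult' DERIV_cmult smooth_has_derivative
          smooth_deriv assms smooth_has_derivative[OF smooth_affine[OF that], of x, unfolded q])
  qed
  obtain p q r s where hk: "h = (\<lambda>x. p + q * x)" "k = (\<lambda>x. r + s * x)"
    using assms by (auto simp: aff1_def)
  have d: "deriv (\<lambda>x. u + v * x) = (\<lambda>_. v)" for u v :: real
    by (rule deriv_real_eqI) (auto intro!: derivative_eq_intros)
  have b: "vf_bracket h k = (\<lambda>x. p * s - q * r)"
    unfolding vf_bracket_def hk d by (simp add: algebra_simps)
  have "coeff_action \<delta> h (coeff_action \<delta> k a) \<alpha> x - coeff_action \<delta> k (coeff_action \<delta> h a) \<alpha> x =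
    (h x * deriv k x - deriv h x * k x) * deriv (a \<alpha>) x"
    unfolding coeff_action_def[of _ h "coeff_action \<delta> k a"]
      coeff_action_def[of _ k "coeff_action \<delta> h a"] D[OF assms(1)] D[OF assms(2)]
    by (simp add: coeff_action_def m_def algebra_simps)
  also have "\<dots> = coeff_action \<delta> (vf_bracket h k) a \<alpha> x"
    unfolding b unfolding coeff_action_def hk d by (simp add: algebra_simps)
  finally show ?thesis by simp
qed

subsection \<open>Cocycles and coboundaries\<close>

definition coboundary ::
  "('n::finite \<Rightarrow> real) \<Rightarrow> real \<Rightarrow> 'n nary_op \<Rightarrow> (real \<Rightarrow> real) \<Rightarrow> 'n nary_op" where
  "coboundary lam \<mu> b = (\<lambda>h. if h \<in> aff1 then op_action lam \<mu> h b else (\<lambda>F x. 0))"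

lemma coboundaries1_altdef: "coboundaries1 lam \<mu> = coboundary lam \<mu> ` diff_ops"
  unfolding coboundaries1_def coboundary_def by blast

lemma aff1_add: "h \<in> aff1 \<Longrightarrow> k \<in> aff1 \<Longrightarrow> (\<lambda>x. h x + k x) \<in> aff1"
proof -
  assume "h \<in> aff1" "k \<in> aff1"
  then obtain a b c d where "h = (\<lambda>x. a + b * x)" "k = (\<lambda>x. c + d * x)"
    by (auto simp: aff1_def)
  then have "(\<lambda>x. h x + k x) = (\<lambda>x. (a + c) + (b + d) * x)"
    by (simp add: algebra_simps)
  then show ?thesis unfolding aff1_def by blast
qed

lemma aff1_scale: "h \<in> aff1 \<Longrightarrow> (\<lambda>x. c * h x) \<in> aff1"
proof -
  assume "h \<in> aff1"
  then obtain a b where "h = (\<lambda>x. a + b * x)" by (auto simp: aff1_def)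
  then have "(\<lambda>x. c * h x) = (\<lambda>x. (c * a) + (c * b) * x)"
    by (simp add: algebra_simps)
  then show ?thesis unfolding aff1_def by blast
qed

lemma aff1_const: "(\<lambda>x. c) \<in> aff1"
  unfolding aff1_def by (rule CollectI, rule exI[of _ c], rule exI[of _ 0]) simp

lemma aff1_ident: "(\<lambda>x. x) \<in> aff1"
  unfolding aff1_def by (rule CollectI, rule exI[of _ 0], rule exI[of _ 1]) simp

text \<open>The slopes are constants, so the bracket is a linear combination of \<open>h\<close> and
  \<open>k\<close>.\<close>

lemma aff1_bracket: "h \<in> aff1 \<Longrightarrow> k \<in> aff1 \<Longrightarrow> vf_bracket h k \<in> aff1"
proof -
  assume h: "h \<in> aff1" and k: "k \<in> aff1"
  have "vf_bracket h k = (\<lambda>x. deriv k 0 * h x + (- deriv h 0) * k x)"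
  proof
    show "vf_bracket h k x = deriv k 0 * h x + (- deriv h 0) * k x" for x
      unfolding vf_bracket_def fun_cong[OF deriv_affine[OF h], of x] fun_cong[OF deriv_affine[OF k], of x]
      by simp
  qed
  then show ?thesis by (simp only:) (intro aff1_add aff1_scale h k)
qed

lemma coeff_action_lincomb:
  assumes "h \<in> aff1" "k \<in> aff1"
  shows "coeff_action \<delta> (\<lambda>x. s * h x + t * k x) a =
    (\<lambda>\<alpha> x. s * coeff_action \<delta> h a \<alpha> x + t * coeff_action \<delta> k a \<alpha> x)"
proof -
  have "deriv (\<lambda>x. s * h x + t * k x) = (\<lambda>x. s * deriv h x + t * deriv k x)"
    by (intro deriv_real_eqI DERIV_add DERIV_cmult smooth_has_derivative smooth_affine assms)
  then show ?thesis
    by (simp add: coeff_action_def fun_eq_iff algebra_simps)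
qed

text \<open>The action preserves the support, so every condition becomes one on coefficients over a
  fixed \<open>S\<close>; the cocycle identity is then \<open>coeff_action_bracket\<close>.\<close>

lemma coboundary_cocycle:
  assumes "b \<in> diff_ops"
  shows "coboundary lam \<mu> b \<in> cocycles1 lam \<mu>"
proof -
  obtain S a where S: "finite S" and a: "\<And>\<alpha>. smooth (a \<alpha>)" and b: "b = diff_op S a"
    by (rule diff_ops_obtain[OF assms]) (rule that)
  let ?c = "coeff_action (\<mu> - (\<Sum>i\<in>UNIV. lam i))"
  have act: "op_action lam \<mu> h (diff_op S c) = diff_op S (?c h c)"
    if "\<And>\<alpha>. smooth (c \<alpha>)" "h \<in> aff1" for h c
    using op_action_diff_op[OF S that] .
  have cb: "coboundary lam \<mu> b h = diff_op S (?c h a)" if "h \<in> aff1" for h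
    using that act[OF a] by (simp add: coboundary_def b)
  have lin: "coboundary lam \<mu> b (\<lambda>x. s * h x + t * k x) =
      (\<lambda>F x. s * coboundary lam \<mu> b h F x + t * coboundary lam \<mu> b k F x)"
    if "h \<in> aff1" "k \<in> aff1" for h k s t
    using that by (simp add: cb aff1_add aff1_scale coeff_action_lincomb diff_op_lincomb)
  have ops: "coboundary lam \<mu> b h \<in> diff_ops" if "h \<in> aff1" for h
    unfolding cb[OF that] by (intro diff_op_in_diff_ops S smooth_coeff_action that a)
  have add: "coboundary lam \<mu> b (\<lambda>x. h x + k x) =
      (\<lambda>F x. coboundary lam \<mu> b h F x + coboundary lam \<mu> b k F x)"
    if "h \<in> aff1" "k \<in> aff1" for h k
    using lin[OF that, of 1 1] by simp
  have scale: "coboundary lam \<mu> b (\<lambda>x. c * h x) = (\<lambda>F x. c * coboundary lam \<mu> b h F x)"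
    if "h \<in> aff1" for h c
    using lin[OF that that, of c 0] by simp
  have outside: "coboundary lam \<mu> b h = (\<lambda>F x. 0)" if "h \<notin> aff1" for h
    using that by (simp add: coboundary_def)
  have bracket: "coboundary lam \<mu> b (vf_bracket h k) =
      (\<lambda>F x. op_action lam \<mu> h (coboundary lam \<mu> b k) F x - op_action lam \<mu> k (coboundary lam \<mu> b h) F x)"
    if "h \<in> aff1" "k \<in> aff1" for h k
  proof -
    have "coboundary lam \<mu> b (vf_bracket h k) = diff_op S (\<lambda>\<alpha> x. ?c h (?c k a) \<alpha> x - ?c k (?c h a) \<alpha> x)"
      unfolding cb[OF aff1_bracket[OF that]] diff_op_def coeff_action_bracket[OF that, of a, OF a] ..
    also have "\<dots> = (\<lambda>F x. diff_op S (?c h (?c k a)) F x - diff_op S (?c k (?c h a)) F x)"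
      using diff_op_lincomb[of 1 S "?c h (?c k a)" "-1" "?c k (?c h a)"] by simp
    finally show ?thesis
      using that by (simp add: cb act smooth_coeff_action a)
  qed
  show ?thesis
    unfolding cocycles1_def cochains1_def by (intro CollectI conjI ballI allI impI ops add scale outside bracket)
qed

lemma coboundaries1_subset_cocycles1: "coboundaries1 lam \<mu> \<subseteq> cocycles1 lam \<mu>"
  by (auto simp: coboundaries1_altdef coboundary_cocycle)

text \<open>Needed to see that any two coboundaries are cohomologous. The difference is the
  coboundary of the difference of the two operators, formed on a common support.\<close>

lemma coboundaries1_diff:
  assumes "\<Theta> \<in> coboundaries1 lam \<mu>" "\<Theta>' \<in> coboundaries1 lam \<mu>"
  shows "(\<lambda>h F x. \<Theta> h F x - \<Theta>' h F x) \<in> coboundaries1 lam \<mu>"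
proof -
  obtain b b' where b: "b \<in> diff_ops" "b' \<in> diff_ops"
    and \<Theta>: "\<Theta> = coboundary lam \<mu> b" "\<Theta>' = coboundary lam \<mu> b'"
    using assms by (auto simp: coboundaries1_altdef)
  obtain S a a' where S: "finite S" "\<And>\<alpha>. smooth (a \<alpha>)" "\<And>\<alpha>. smooth (a' \<alpha>)"
    "b = diff_op S a" "b' = diff_op S a'"
    by (rule diff_ops_common_support[OF b]) (rule that)
  let ?c = "coeff_action (\<mu> - (\<Sum>i\<in>UNIV. lam i))"
  define e where "e = (\<lambda>\<alpha> x. 1 * a \<alpha> x + (-1) * a' \<alpha> x)"
  have e: "smooth (e \<alpha>)" for \<alpha>
    unfolding e_def by (intro smooth_add smooth_mult smooth_const S)
  have De: "deriv (e \<alpha>) = (\<lambda>x. 1 * deriv (a \<alpha>) x + (-1) * deriv (a' \<alpha>) x)" for \<alpha>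
    unfolding e_def by (intro deriv_real_eqI DERIV_add DERIV_cmult smooth_has_derivative S)
  have ce: "?c h e = (\<lambda>\<alpha> x. 1 * ?c h a \<alpha> x + (-1) * ?c h a' \<alpha> x)" for h
    unfolding coeff_action_def De by (simp add: e_def algebra_simps)
  have "diff_op S (?c h e) F x = diff_op S (?c h a) F x - diff_op S (?c h a') F x" for h F x
    unfolding ce diff_op_lincomb[symmetric] by simp
  then have "(\<lambda>h F x. \<Theta> h F x - \<Theta>' h F x) = coboundary lam \<mu> (diff_op S e)"
    by (simp add: fun_eq_iff \<Theta> coboundary_def S op_action_diff_op e)
  then show ?thesis
    unfolding coboundaries1_altdef using diff_op_in_diff_ops[of S e, OF S(1) e] by blast
qed

section \<open>Normal form of cocycles and computation of the cohomology\<close>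

lemma cocycle_linear:
  assumes "\<Omega> \<in> cocycles1 lam \<mu>" "h \<in> aff1" "k \<in> aff1"
  shows "\<Omega> (\<lambda>x. s * h x + t * k x) = (\<lambda>F x. s * \<Omega> h F x + t * \<Omega> k F x)"
proof -
  have add: "\<Omega> (\<lambda>x. u x + v x) = (\<lambda>F x. \<Omega> u F x + \<Omega> v F x)" if "u \<in> aff1" "v \<in> aff1" for u v
    using assms(1) that by (simp add: cocycles1_def cochains1_def)
  have scale: "\<Omega> (\<lambda>x. c * u x) = (\<lambda>F x. c * \<Omega> u F x)" if "u \<in> aff1" for c u
    using assms(1) that by (simp add: cocycles1_def cochains1_def)
  show ?thesis
    using add[OF aff1_scale[OF assms(2)] aff1_scale[OF assms(3)], of s t]
    by (simp only: scale assms(2,3))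
qed

lemma cohomology1_trivialI:
  assumes "cocycles1 lam \<mu> \<subseteq> coboundaries1 lam \<mu>"
  shows "cohomology1 lam \<mu> = {coboundaries1 lam \<mu>}"
proof -
  have eq: "cocycles1 lam \<mu> = coboundaries1 lam \<mu>"
    using assms coboundaries1_subset_cocycles1 by blast
  have "cohomologous lam \<mu> `` {\<Omega>} = coboundaries1 lam \<mu>" if "\<Omega> \<in> coboundaries1 lam \<mu>" for \<Omega>
    using that coboundaries1_diff by (auto simp: cohomologous_def eq)
  \<comment> \<open>Without an element the quotient would be empty instead of having a single
    class.\<close>
  moreover have "diff_op {} (\<lambda>\<alpha> x. 0) \<in> diff_ops"
    by (intro diff_op_in_diff_ops) auto
  then have "coboundaries1 lam \<mu> \<noteq> {}"
    unfolding coboundaries1_altdef by blast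
  ultimately show ?thesis
    unfolding cohomology1_def quotient_def eq by auto
qed

text \<open>Serves both cases of the theorem: the remainder is supported where |\<alpha>| =
  \<delta>, and no such index exists when \<delta> is not a natural number.\<close>

lemma cocycle_normal_form:
  fixes lam :: "'n::finite \<Rightarrow> real"
  assumes "\<delta> = \<mu> - (\<Sum>i\<in>UNIV. lam i)" and \<Omega>: "\<Omega> \<in> cocycles1 lam \<mu>"
  obtains \<Theta> S and c :: "('n \<Rightarrow> nat) \<Rightarrow> real" where "\<Theta> \<in> coboundaries1 lam \<mu>" "finite S"
    "\<And>\<alpha>. \<alpha> \<in> S \<Longrightarrow> real (\<Sum>i\<in>UNIV. \<alpha> i) = \<delta>"
    "\<And>h. h \<in> aff1 \<Longrightarrow> (\<lambda>F x. \<Omega> h F x - \<Theta> h F x) = diff_op S (\<lambda>\<alpha> x. c \<alpha> * deriv h x)"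
proof -
  let ?one = "\<lambda>x::real. 1::real" and ?id = "\<lambda>x::real. x"
  note [simp] = aff1_const aff1_ident
  have ops: "\<Omega> ?one \<in> diff_ops" "\<Omega> ?id \<in> diff_ops"
    using \<Omega> by (auto simp: cocycles1_def cochains1_def)
  obtain S a b where S: "finite S" and a: "\<And>\<alpha>. smooth (a \<alpha>)" and b: "\<And>\<alpha>. smooth (b \<alpha>)"
    and \<Omega>1: "\<Omega> ?one = diff_op S a" and \<Omega>x: "\<Omega> ?id = diff_op S b"
    by (rule diff_ops_common_support[OF ops]) (rule that)
  define m where "m = (\<lambda>\<alpha>::'n \<Rightarrow> nat. \<delta> - real (\<Sum>i\<in>UNIV. \<alpha> i))"
  have act: "op_action lam \<mu> h (diff_op S e) = diff_op S (coeff_action \<delta> h e)"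
    if "\<And>\<alpha>. smooth (e \<alpha>)" "h \<in> aff1" for h e
    using op_action_diff_op[OF S that] assms(1) by simp
  have c1: "coeff_action \<delta> ?one e \<alpha> x = deriv (e \<alpha>) x" for e x and \<alpha> :: "'n \<Rightarrow> nat"
    by (simp add: coeff_action_def)
  have cx: "coeff_action \<delta> ?id e \<alpha> x = x * deriv (e \<alpha>) x + m \<alpha> * e \<alpha> x" for e \<alpha> x
    by (simp add: coeff_action_def m_def)
  have "diff_op S a = \<Omega> (vf_bracket ?one ?id)"
    by (simp add: vf_bracket_def \<Omega>1)
  also have "\<dots> = (\<lambda>F x. op_action lam \<mu> ?one (\<Omega> ?id) F x - op_action lam \<mu> ?id (\<Omega> ?one) F x)"
    using \<Omega> unfolding cocycles1_def by simp
  also have "\<dots> = (\<lambda>F x. 1 * diff_op S (coeff_action \<delta> ?one b) F x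
      + (-1) * diff_op S (coeff_action \<delta> ?id a) F x)"
    by (simp add: \<Omega>1 \<Omega>x act[OF a] act[OF b])
  finally have "diff_op S a = diff_op S
      (\<lambda>\<alpha> x. 1 * coeff_action \<delta> ?one b \<alpha> x + (-1) * coeff_action \<delta> ?id a \<alpha> x)"
    unfolding diff_op_lincomb .
  \<comment> \<open>An identity between operators on one finite support holds coefficient by
    coefficient.\<close>
  then have coeff_eq: "a \<alpha> = (\<lambda>x. 1 * coeff_action \<delta> ?one b \<alpha> x + (-1) * coeff_action \<delta> ?id a \<alpha> x)"
    if "\<alpha> \<in> S" for \<alpha>
    using diff_op_coeff_unique[OF S _ that] by blast
  have cocycle: "a \<alpha> x = deriv (b \<alpha>) x - (x * deriv (a \<alpha>) x + m \<alpha> * a \<alpha> x)" if "\<alpha> \<in> S" for \<alpha> x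
    using fun_cong[OF coeff_eq[OF that], of x] unfolding c1 cx by (rule trans) simp
  have "\<exists>g. smooth g \<and> deriv g = a \<alpha>" for \<alpha>
    using smooth_antiderivative[OF a] by metis
  then obtain g where g: "\<And>\<alpha>. smooth (g \<alpha>)" "\<And>\<alpha>. deriv (g \<alpha>) = a \<alpha>"
    by metis
  \<comment> \<open>The derivative is b' - x a' - a - m a, which is zero by
    \<open>cocycle\<close>.\<close>
  have "\<exists>c. \<forall>x. b \<alpha> x - (x * a \<alpha> x + m \<alpha> * g \<alpha> x) = c" if "\<alpha> \<in> S" for \<alpha>
  proof -
    have "((\<lambda>x. b \<alpha> x - (x * a \<alpha> x + m \<alpha> * g \<alpha> x)) has_real_derivative
        deriv (b \<alpha>) x - ((x * deriv (a \<alpha>) x + 1 * a \<alpha> x) + m \<alpha> * deriv (g \<alpha>) x)) (at x)" for x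
      by (intro DERIV_diff DERIV_add DERIV_mult' DERIV_cmult smooth_has_derivative a b g DERIV_ident)
    moreover have "deriv (b \<alpha>) x - ((x * deriv (a \<alpha>) x + 1 * a \<alpha> x) + m \<alpha> * deriv (g \<alpha>) x) = 0" for x
      using cocycle[OF that, of x] unfolding g(2) by linarith
    ultimately have "((\<lambda>x. b \<alpha> x - (x * a \<alpha> x + m \<alpha> * g \<alpha> x)) has_real_derivative 0) (at x)" for x
      by (simp only:)
    then show ?thesis
      using DERIV_isconst_all by blast
  qed
  then obtain c where c: "\<And>\<alpha> x. \<alpha> \<in> S \<Longrightarrow> b \<alpha> x - (x * a \<alpha> x + m \<alpha> * g \<alpha> x) = c \<alpha>"
    by metis
  \<comment> \<open>The shift leaves the derivative unchanged and adds \<open>c \<alpha>\<close> to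
    \<open>m \<alpha> * g \<alpha> x\<close>. Where \<open>m \<alpha> = 0\<close> no constant shift
    can have this effect, and the term \<open>c \<alpha>\<close> survives.\<close>
  define e where "e = (\<lambda>\<alpha> x. g \<alpha> x + (if m \<alpha> = 0 then 0 else c \<alpha> / m \<alpha>))"
  have e: "smooth (e \<alpha>)" for \<alpha>
    unfolding e_def by (intro smooth_add g smooth_const)
  have De: "deriv (e \<alpha>) = a \<alpha>" for \<alpha>
  proof (rule deriv_real_eqI)
    show "(e \<alpha> has_real_derivative a \<alpha> x) (at x)" for x
      using smooth_has_derivative[OF g(1), of \<alpha> x] unfolding e_def g(2)
      by (auto intro!: derivative_eq_intros)
  qed
  define R where "R = {\<alpha>\<in>S. m \<alpha> = 0}"
  show thesis
  proof
    show "coboundary lam \<mu> (diff_op S e) \<in> coboundaries1 lam \<mu>"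
      unfolding coboundaries1_altdef using diff_op_in_diff_ops[of S e, OF S e] by blast
    show "finite R" using S by (simp add: R_def)
    show "real (\<Sum>i\<in>UNIV. \<alpha> i) = \<delta>" if "\<alpha> \<in> R" for \<alpha>
      using that by (simp add: R_def m_def)
    fix h assume h: "h \<in> aff1"
    then obtain p q where pq: "h = (\<lambda>x. p + q * x)" by (auto simp: aff1_def)
    have dh: "deriv h = (\<lambda>_. q)"
      unfolding pq by (rule deriv_real_eqI) (auto intro!: derivative_eq_intros)
    have "\<Omega> h = \<Omega> (\<lambda>x. p * ?one x + q * ?id x)"
      by (simp add: pq)
    also have "\<dots> = (\<lambda>F x. p * \<Omega> ?one F x + q * \<Omega> ?id F x)"
      by (rule cocycle_linear[OF \<Omega> aff1_const aff1_ident])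
    finally have \<Omega>h: "\<Omega> h = diff_op S (\<lambda>\<alpha> x. p * a \<alpha> x + q * b \<alpha> x)"
      by (simp only: \<Omega>1 \<Omega>x diff_op_lincomb)
    have "(\<lambda>F x. \<Omega> h F x - coboundary lam \<mu> (diff_op S e) h F x) =
        diff_op S (\<lambda>\<alpha> x. 1 * (p * a \<alpha> x + q * b \<alpha> x) + (-1) * coeff_action \<delta> h e \<alpha> x)"
      using h by (simp only: diff_op_lincomb[symmetric] \<Omega>h coboundary_def act[OF e] if_True) simp
    also have "\<dots> = diff_op S (\<lambda>\<alpha>. if \<alpha> \<in> R then (\<lambda>x. c \<alpha> * deriv h x) else (\<lambda>x. 0))"
    proof -
      have "1 * (p * a \<alpha> x + q * b \<alpha> x) + (-1) * coeff_action \<delta> h e \<alpha> x =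
          (if \<alpha> \<in> R then (\<lambda>x. c \<alpha> * deriv h x) else (\<lambda>x. 0)) x" if "\<alpha> \<in> S" for \<alpha> x
      proof -
        \<comment> \<open>On \<open>S\<close>, not lying in \<open>R\<close> means
          \<open>m \<alpha> \<noteq> 0\<close>, so the division in \<open>e\<close> cancels.\<close>
        have "m \<alpha> * e \<alpha> x = m \<alpha> * g \<alpha> x + (if \<alpha> \<in> R then 0 else c \<alpha>)"
          using that by (simp add: e_def R_def algebra_simps)
        then have me: "m \<alpha> * e \<alpha> x = b \<alpha> x - x * a \<alpha> x - (if \<alpha> \<in> R then c \<alpha> else 0)"
          using c[OF that, of x] by auto
        have "coeff_action \<delta> h e \<alpha> x = (p + q * x) * a \<alpha> x + q * (m \<alpha> * e \<alpha> x)"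
          by (simp add: coeff_action_def De dh m_def pq)
        then show ?thesis
          unfolding me by (cases "\<alpha> \<in> R") (simp_all add: dh algebra_simps)
      qed
      then show ?thesis
        by (intro ext) (simp add: diff_op_def del: mult_minus_left)
    qed
    also have "\<dots> = diff_op R (\<lambda>\<alpha> x. c \<alpha> * deriv h x)"
      by (rule diff_op_extend[symmetric]) (use S in \<open>auto simp: R_def\<close>)
    finally show "(\<lambda>F x. \<Omega> h F x - coboundary lam \<mu> (diff_op S e) h F x) =
      diff_op R (\<lambda>\<alpha> x. c \<alpha> * deriv h x)" .
  qed
qed

theorem theorem3p2:
  fixes lam :: "'n::finite \<Rightarrow> real" and \<mu> \<delta> :: real
  assumes "\<delta> = \<mu> - (\<Sum>i\<in>UNIV. lam i)"
  shows "(\<delta> \<notin> \<nat> \<longrightarrow> cohomology1 lam \<mu> = {coboundaries1 lam \<mu>}) \<and>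
    (\<forall>d::nat. \<delta> = real d \<longrightarrow>
      (\<forall>\<Omega>\<in>cocycles1 lam \<mu>. \<exists>\<Theta>\<in>coboundaries1 lam \<mu>. \<exists>B :: ('n \<Rightarrow> nat) \<Rightarrow> real.
        \<forall>h\<in>aff1. \<forall>F\<in>smooth_tuples. \<forall>x.
          \<Omega> h F x - \<Theta> h F x =
            (\<Sum>\<alpha> | (\<Sum>i\<in>UNIV. \<alpha> i) = d. B \<alpha> * deriv h x * multi_deriv \<alpha> F x)))"
proof (intro conjI impI allI ballI)
  assume "\<delta> \<notin> \<nat>"
  show "cohomology1 lam \<mu> = {coboundaries1 lam \<mu>}"
  proof (rule cohomology1_trivialI, rule subsetI)
    fix \<Omega> assume \<Omega>: "\<Omega> \<in> cocycles1 lam \<mu>"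
    obtain \<Theta> S c where \<Theta>: "\<Theta> \<in> coboundaries1 lam \<mu>" and "finite S"
      and S: "\<And>\<alpha>. \<alpha> \<in> S \<Longrightarrow> real (\<Sum>i\<in>UNIV. \<alpha> i) = \<delta>"
      and diff: "\<And>h. h \<in> aff1 \<Longrightarrow> (\<lambda>F x. \<Omega> h F x - \<Theta> h F x) = diff_op S (\<lambda>\<alpha> x. c \<alpha> * deriv h x)"
      by (rule cocycle_normal_form[OF assms \<Omega>]) (rule that)
    \<comment> \<open>An index in \<open>S\<close> would exhibit \<delta> as the natural number
      |\<alpha>|.\<close>
    have "S = {}" using S \<open>\<delta> \<notin> \<nat>\<close> by (metis of_nat_in_Nats ex_in_conv)
    have "\<Omega> h = \<Theta> h" for h
    proof (cases "h \<in> aff1")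
      case True
      have "\<Omega> h F x = \<Theta> h F x" for F x
        using fun_cong[OF fun_cong[OF diff[OF True]], of F x]
        by (simp add: \<open>S = {}\<close> diff_op_def split: if_splits)
      then show ?thesis by blast
    next
      \<comment> \<open>Outside \<open>aff1\<close> both maps are zero by the convention on
        cochains.\<close>
      case False
      moreover have "\<Theta> \<in> cocycles1 lam \<mu>"
        using \<Theta> coboundaries1_subset_cocycles1 by blast
      ultimately show ?thesis using \<Omega> by (simp add: cocycles1_def cochains1_def)
    qed
    then have "\<Omega> = \<Theta>" by blast
    with \<Theta> show "\<Omega> \<in> coboundaries1 lam \<mu>" by simp
  qed
next
  fix d :: nat and \<Omega>
  assume d: "\<delta> = real d" and \<Omega>: "\<Omega> \<in> cocycles1 lam \<mu>"
  obtain \<Theta> S c where \<Theta>: "\<Theta> \<in> coboundaries1 lam \<mu>" and "finite S"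
    and S: "\<And>\<alpha>. \<alpha> \<in> S \<Longrightarrow> real (\<Sum>i\<in>UNIV. \<alpha> i) = \<delta>"
    and diff: "\<And>h. h \<in> aff1 \<Longrightarrow> (\<lambda>F x. \<Omega> h F x - \<Theta> h F x) = diff_op S (\<lambda>\<alpha> x. c \<alpha> * deriv h x)"
    by (rule cocycle_normal_form[OF assms \<Omega>]) (rule that)
  have sub: "S \<subseteq> {\<alpha>. (\<Sum>i\<in>UNIV. \<alpha> i) = d}"
    using S unfolding d of_nat_eq_iff by blast
  show "\<exists>\<Theta>\<in>coboundaries1 lam \<mu>. \<exists>B :: ('n \<Rightarrow> nat) \<Rightarrow> real.
      \<forall>h\<in>aff1. \<forall>F\<in>smooth_tuples. \<forall>x. \<Omega> h F x - \<Theta> h F x =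
        (\<Sum>\<alpha> | (\<Sum>i\<in>UNIV. \<alpha> i) = d. B \<alpha> * deriv h x * multi_deriv \<alpha> F x)"
  proof (intro bexI[OF _ \<Theta>] exI ballI allI)
    fix h F x assume h: "h \<in> aff1" and F: "F \<in> (smooth_tuples :: ('n \<Rightarrow> real \<Rightarrow> real) set)"
    have "\<Omega> h F x - \<Theta> h F x = diff_op S (\<lambda>\<alpha> x. c \<alpha> * deriv h x) F x"
      by (rule fun_cong[OF fun_cong[OF diff[OF h]]])
    also have "\<dots> = (\<Sum>\<alpha>\<in>S. c \<alpha> * deriv h x * multi_deriv \<alpha> F x)"
      using F by (simp add: diff_op_def)
    \<comment> \<open>The witness for \<open>B\<close> is \<open>c\<close> on \<open>S\<close>,
      extended by zero to all indices of order \<open>d\<close>.\<close>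
    also have "\<dots> = (\<Sum>\<alpha> | (\<Sum>i\<in>UNIV. \<alpha> i) = d.
        (if \<alpha> \<in> S then c \<alpha> else 0) * deriv h x * multi_deriv \<alpha> F x)"
      by (intro sum.mono_neutral_cong_left finite_multi_indices sub) auto
    finally show "\<Omega> h F x - \<Theta> h F x = (\<Sum>\<alpha> | (\<Sum>i\<in>UNIV. \<alpha> i) = d.
        (if \<alpha> \<in> S then c \<alpha> else 0) * deriv h x * multi_deriv \<alpha> F x)" .
  qed
qed

end
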